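(* In the model-free setting described in the context, with $\mathbf{A}=E(WW^T)$, assume that $\frac{\|\mathbf{A}\|_F^2}{n^2}\to0$ as $n\to\infty$, and that $\tau^2$ is bounded. Then $$\hat\tau^2-\tau^2\overset{p}{\rightarrow}0 .$$
   Context: Setting. $(X_1,Y_1),\dots,(X_n,Y_n)$ are i.i.d. copies of $(X,Y)$ with $X\in\mathbb{R}^p$, $Y\in\mathbb{R}$, $E(Y^2)<\infty$, $E(X)=0$ and $\mathrm{Var}(X)=\mathbf{I}$. No linearity of $E(Y|X)$ is assumed. $(\alpha,\beta)$ are the best linear predictor coefficients, $(\alpha,\beta)=\arg\min_{a\in\mathbb{R},b\in\mathbb{R}^p}E(Y-a-b^TX)^2$, so $\beta=E(XY)$ and $\alpha=E(Y)$. The signal level is $\tau^2=\beta^T\mathrm{Var}(X)\beta=\|\beta\|^2$. Limits are as $n\to\infty$ with $p=p_n$ a function of $n$. $W=XY$, $W_{ij}=X_{ij}Y_i$, $W_i=(W_{i1},\dots,W_{ip})^T$; $\|\cdot\|_F$ is the Frobenius norm. The naive estimator is $\hat\tau^2=\binom n2^{-1}\sum_{i_1<i_2}W_{i_1}^TW_{i_2}$. *)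

theory Defs
  imports "HOL-Probability.Probability"
begin

text \<open>Vectors in $\mathbf{R}^p$ are functions on $\{0,\dots,p-1\}$ that are \<^const>\<open>undefined\<close>
  elsewhere, so that the dimension may depend on the sample size.\<close>

abbreviation Rvec :: "nat \<Rightarrow> (nat \<Rightarrow> real) measure" where
  "Rvec p \<equiv> PiM {..<p} (\<lambda>_. borel)"

definition iid_copies ::
  "'a measure \<Rightarrow> 'b measure \<Rightarrow> ('a \<Rightarrow> 'b) \<Rightarrow> nat \<Rightarrow> (nat \<Rightarrow> 'a \<Rightarrow> 'b) \<Rightarrow> bool" where
  "iid_copies M S Z n Zs \<longleftrightarrow>
     Z \<in> measurable M S \<and>
     prob_space.indep_vars M (\<lambda>_. S) Zs {..<n} \<and>
     (\<forall>i<n. distr M S (Zs i) = distr M S Z)"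

definition cov_matrix :: "'a measure \<Rightarrow> ('a \<Rightarrow> nat \<Rightarrow> real) \<Rightarrow> nat \<Rightarrow> nat \<Rightarrow> real" where
  "cov_matrix M X j k =
     (\<integral>\<omega>. (X \<omega> j - (\<integral>\<omega>'. X \<omega>' j \<partial>M)) * (X \<omega> k - (\<integral>\<omega>'. X \<omega>' k \<partial>M)) \<partial>M)"

text \<open>\<^const>\<open>arg_min\<close> selects an arbitrary minimizer; with finite second moments and a
  nonsingular covariance matrix the minimizer $(\alpha,\beta)$ exists and is unique.\<close>

definition best_linear_predictor ::
  "'a measure \<Rightarrow> nat \<Rightarrow> ('a \<Rightarrow> nat \<Rightarrow> real) \<Rightarrow> ('a \<Rightarrow> real) \<Rightarrow> real \<times> (nat \<Rightarrow> real)" where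
  "best_linear_predictor M p X Y =
     arg_min (\<lambda>(a, b). \<integral>\<omega>. (Y \<omega> - a - (\<Sum>j<p. b j * X \<omega> j))\<^sup>2 \<partial>M)
             (\<lambda>(a, b). b \<in> space (Rvec p))"

definition signal_level :: "'a measure \<Rightarrow> nat \<Rightarrow> ('a \<Rightarrow> nat \<Rightarrow> real) \<Rightarrow> ('a \<Rightarrow> real) \<Rightarrow> real" where
  "signal_level M p X Y =
     (let \<beta> = snd (best_linear_predictor M p X Y)
      in \<Sum>j<p. \<Sum>k<p. \<beta> j * cov_matrix M X j k * \<beta> k)"

definition W :: "('a \<Rightarrow> nat \<Rightarrow> real) \<Rightarrow> ('a \<Rightarrow> real) \<Rightarrow> 'a \<Rightarrow> nat \<Rightarrow> real" where
  "W X Y \<omega> j = X \<omega> j * Y \<omega>"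

definition second_moment_matrix :: "'a measure \<Rightarrow> ('a \<Rightarrow> nat \<Rightarrow> real) \<Rightarrow> nat \<Rightarrow> nat \<Rightarrow> real" where
  "second_moment_matrix M V j k = (\<integral>\<omega>. V \<omega> j * V \<omega> k \<partial>M)"

definition frobenius_norm :: "nat \<Rightarrow> (nat \<Rightarrow> nat \<Rightarrow> real) \<Rightarrow> real" where
  "frobenius_norm p A = sqrt (\<Sum>j<p. \<Sum>k<p. (A j k)\<^sup>2)"

definition naive_estimator ::
  "nat \<Rightarrow> nat \<Rightarrow> (nat \<Rightarrow> 'a \<Rightarrow> nat \<Rightarrow> real) \<Rightarrow> (nat \<Rightarrow> 'a \<Rightarrow> real) \<Rightarrow> 'a \<Rightarrow> real" where
  "naive_estimator n p Xs Ys \<omega> =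
     (\<Sum>i\<^sub>2<n. \<Sum>i\<^sub>1<i\<^sub>2. \<Sum>j<p. W (Xs i\<^sub>1) (Ys i\<^sub>1) \<omega> j * W (Xs i\<^sub>2) (Ys i\<^sub>2) \<omega> j)
       / real (n choose 2)"

text \<open>Convergence in probability to a constant; the probability space may change with \<open>n\<close>.\<close>

definition tendsto_in_prob :: "(nat \<Rightarrow> 'a measure) \<Rightarrow> (nat \<Rightarrow> 'a \<Rightarrow> real) \<Rightarrow> real \<Rightarrow> bool" where
  "tendsto_in_prob M Z c \<longleftrightarrow>
     (\<forall>\<epsilon>>0. (\<lambda>n. measure (M n) {\<omega> \<in> space (M n). \<bar>Z n \<omega> - c\<bar> > \<epsilon>}) \<longlonglongrightarrow> 0)"

end

theory Submission
  imports Defs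
begin

text \<open>
  Because \<open>X\<close> is centred with identity covariance, the slope of the best linear predictor is
  \<open>\<beta> = E(XY) = E(W)\<close> and the signal level is \<open>\<tau>\<^sup>2 = \<parallel>\<beta>\<parallel>\<^sup>2\<close>
  (\<open>best_linear_predictor_slope\<close>).  The naive estimator is thus an unbiased U-statistic for
  \<open>\<tau>\<^sup>2\<close>, and consistency follows from Chebyshev's inequality once its mean squared error is shown
  to vanish.

  Write \<open>W\<^sub>i = \<beta> + V\<^sub>i\<close> with independent centred \<open>V\<^sub>i\<close> of covariance matrix
  \<open>C = A - \<beta>\<beta>\<^sup>T\<close>.  Expanding the products in the estimator gives the Hoeffding decomposition
  \<open>2/n \<Sum>\<^sub>i \<beta>\<^sup>T V\<^sub>i + (n choose 2)\<^sup>-\<^sup>1 \<Sum>\<^sub>i\<^sub><\<^sub>k V\<^sub>i\<^sup>T V\<^sub>k\<close> of the error.  The linear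
  part has second moment \<open>4/n \<beta>\<^sup>T C \<beta>\<close>.  The double sum \<open>D\<^sub>m = \<Sum>\<^sub>i\<^sub><\<^sub>k\<^sub><\<^sub>m V\<^sub>i\<^sup>T V\<^sub>k\<close> is a martingale:
  its increments \<open>S\<^sub>m\<^sup>T V\<^sub>m\<close>, where \<open>S\<^sub>m = \<Sum>\<^sub>i\<^sub><\<^sub>m V\<^sub>i\<close>, multiply a function of the past by
  an independent centred vector, and each has second moment \<open>m \<parallel>C\<parallel>\<^sub>F\<^sup>2\<close>.  Hence
  \<open>E(D\<^sub>n\<^sup>2) = (n choose 2) \<parallel>C\<parallel>\<^sub>F\<^sup>2\<close> (\<open>pair_sum_second_moment\<close>), a computation that involves no
  case distinction on how two pairs of indices overlap.

  Finally \<open>\<parallel>C\<parallel>\<^sub>F \<le> \<parallel>A\<parallel>\<^sub>F\<close> and \<open>\<beta>\<^sup>T C \<beta> \<le> \<parallel>A\<parallel>\<^sub>F \<tau>\<^sup>2\<close>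
  (\<open>frobenius_norm_centred_le\<close>), so the mean squared error is of order
  \<open>\<tau>\<^sup>2 \<parallel>A\<parallel>\<^sub>F/n + (\<parallel>A\<parallel>\<^sub>F/n)\<^sup>2\<close>, which tends to \<open>0\<close> when \<open>\<tau>\<^sup>2\<close> is bounded.
\<close>

section \<open>Square-integrable random variables\<close>

lemma integrable_mult_of_square_integrable:
  fixes f g :: "'a \<Rightarrow> real"
  assumes [measurable]: "f \<in> borel_measurable M" "g \<in> borel_measurable M"
    and f: "integrable M (\<lambda>\<omega>. (f \<omega>)\<^sup>2)" and g: "integrable M (\<lambda>\<omega>. (g \<omega>)\<^sup>2)"
  shows "integrable M (\<lambda>\<omega>. f \<omega> * g \<omega>)"
proof (rule Bochner_Integration.integrable_bound)
  show "integrable M (\<lambda>\<omega>. (f \<omega>)\<^sup>2 + (g \<omega>)\<^sup>2)"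
    using f g by simp
  have "\<bar>x * y\<bar> \<le> x\<^sup>2 + y\<^sup>2" for x y :: real
    using sum_squares_bound[of "\<bar>x\<bar>" "\<bar>y\<bar>"] mult_nonneg_nonneg[of "\<bar>x\<bar>" "\<bar>y\<bar>"]
    unfolding abs_mult power2_abs by linarith
  then show "AE \<omega> in M. norm (f \<omega> * g \<omega>) \<le> norm ((f \<omega>)\<^sup>2 + (g \<omega>)\<^sup>2)"
    by (intro AE_I2) (simp add: abs_mult)
qed measurable

lemma integrable_square_add:
  fixes f g :: "'a \<Rightarrow> real"
  assumes "f \<in> borel_measurable M" "g \<in> borel_measurable M"
    and "integrable M (\<lambda>\<omega>. (f \<omega>)\<^sup>2)" "integrable M (\<lambda>\<omega>. (g \<omega>)\<^sup>2)"
  shows "integrable M (\<lambda>\<omega>. (f \<omega> + g \<omega>)\<^sup>2)"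
  using assms integrable_mult_of_square_integrable[OF assms]
  by (simp add: power2_sum mult.assoc)

lemma linear_combination_second_moment:
  fixes U :: "'i \<Rightarrow> 'a \<Rightarrow> real"
  assumes meas: "\<And>j. j \<in> I \<Longrightarrow> U j \<in> borel_measurable M"
    and sq: "\<And>j. j \<in> I \<Longrightarrow> integrable M (\<lambda>\<omega>. (U j \<omega>)\<^sup>2)"
    and G: "\<And>j k. j \<in> I \<Longrightarrow> k \<in> I \<Longrightarrow> (\<integral>\<omega>. U j \<omega> * U k \<omega> \<partial>M) = G j k"
  shows "has_bochner_integral M (\<lambda>\<omega>. (\<Sum>j\<in>I. b j * U j \<omega>)\<^sup>2)
           (\<Sum>j\<in>I. \<Sum>k\<in>I. b j * b k * G j k)"
proof -
  have "has_bochner_integral M (\<lambda>\<omega>. \<Sum>j\<in>I. \<Sum>k\<in>I. b j * b k * (U j \<omega> * U k \<omega>))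
          (\<Sum>j\<in>I. \<Sum>k\<in>I. b j * b k * G j k)"
    using meas sq G
    by (intro has_bochner_integral_sum has_bochner_integral_mult_right)
       (auto simp: has_bochner_integral_iff intro: integrable_mult_of_square_integrable)
  then show ?thesis
    by (simp add: power2_eq_square sum_product algebra_simps)
qed

section \<open>The slope of the best linear predictor\<close>

text \<open>
  The residual \<open>R\<close> at the candidate \<open>(\<alpha>, \<beta>) = (E Y, E(XY))\<close> is orthogonal to the constants and to
  every \<open>X\<^sub>j\<close>, so by Pythagoras the prediction error at \<open>(a, b)\<close> is
  \<open>E(R\<^sup>2) + (\<alpha> - a)\<^sup>2 + \<parallel>\<beta> - b\<parallel>\<^sup>2\<close>.  Hence a minimizer exists and the slope of any minimizer agrees
  with \<open>\<beta>\<close> on the first \<open>p\<close> coordinates, whichever one \<^const>\<open>arg_min\<close> selects.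
\<close>

lemma (in prob_space) best_linear_predictor_slope:
  assumes Ym [measurable]: "Y \<in> borel_measurable M"
    and Xm [measurable]: "\<And>j. j < p \<Longrightarrow> (\<lambda>\<omega>. X \<omega> j) \<in> borel_measurable M"
    and Y2: "integrable M (\<lambda>\<omega>. (Y \<omega>)\<^sup>2)"
    and X2: "\<And>j. j < p \<Longrightarrow> integrable M (\<lambda>\<omega>. (X \<omega> j)\<^sup>2)"
    and mean: "\<And>j. j < p \<Longrightarrow> expectation (\<lambda>\<omega>. X \<omega> j) = 0"
    and var: "\<And>j k. j < p \<Longrightarrow> k < p \<Longrightarrow>
                expectation (\<lambda>\<omega>. X \<omega> j * X \<omega> k) = (if j = k then 1 else 0)"
    and j: "j < p"
  shows "snd (best_linear_predictor M p X Y) j = expectation (\<lambda>\<omega>. X \<omega> j * Y \<omega>)"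
proof -
  define \<beta> where "\<beta> j = expectation (\<lambda>\<omega>. X \<omega> j * Y \<omega>)" for j
  define \<alpha> where "\<alpha> = expectation Y"
  define R where "R \<omega> = Y \<omega> - \<alpha> - (\<Sum>j<p. \<beta> j * X \<omega> j)" for \<omega>
  define f where "f = (\<lambda>(a, b). \<integral>\<omega>. (Y \<omega> - a - (\<Sum>j<p. b j * X \<omega> j))\<^sup>2 \<partial>M)"
  have Xi: "integrable M (\<lambda>\<omega>. X \<omega> j)" if "j < p" for j
    using square_integrable_imp_integrable[OF Xm X2] that by simp
  have Yi: "integrable M Y"
    using square_integrable_imp_integrable[OF Ym Y2] .
  have XX: "integrable M (\<lambda>\<omega>. X \<omega> j * X \<omega> k)" if "j < p" "k < p" for j k
    using that by (intro integrable_mult_of_square_integrable Xm X2)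
  have XY: "integrable M (\<lambda>\<omega>. X \<omega> j * Y \<omega>)" if "j < p" for j
    using that by (intro integrable_mult_of_square_integrable Xm X2 Ym Y2)
  have lin2: "has_bochner_integral M (\<lambda>\<omega>. (\<Sum>j<p. d j * X \<omega> j)\<^sup>2) (\<Sum>j<p. (d j)\<^sup>2)" for d
  proof -
    have "(\<Sum>j<p. \<Sum>k<p. d j * d k * (if j = k then 1 else 0)) = (\<Sum>j<p. (d j)\<^sup>2)"
      by (rule sum.cong) (simp_all add: power2_eq_square if_distrib[of "(*) _"] cong: if_cong)
    with linear_combination_second_moment[where I="{..<p}" and U="\<lambda>j \<omega>. X \<omega> j" and b=d
        and G="\<lambda>j k. if j = k then 1 else 0" and M=M]
    show ?thesis using Xm X2 var by simp
  qed
  have R_meas [measurable]: "R \<in> borel_measurable M"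
    unfolding R_def using Xm Ym by (intro borel_measurable_diff borel_measurable_sum borel_measurable_times) auto
  have R2: "integrable M (\<lambda>\<omega>. (R \<omega>)\<^sup>2)"
  proof -
    have "integrable M (\<lambda>\<omega>. ((Y \<omega> + - \<alpha>) + (\<Sum>j<p. - \<beta> j * X \<omega> j))\<^sup>2)"
      using Y2 lin2[of "\<lambda>j. - \<beta> j"] Xm
      by (intro integrable_square_add) (auto simp: has_bochner_integral_iff)
    then show ?thesis by (simp add: R_def sum_negf)
  qed
  have R_mean: "has_bochner_integral M R 0"
  proof -
    have "has_bochner_integral M R (\<alpha> - \<alpha> - (\<Sum>j<p. \<beta> j * 0))"
      unfolding R_def using Xi Yi mean
      by (intro has_bochner_integral_diff has_bochner_integral_sum has_bochner_integral_mult_right)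
         (auto simp: has_bochner_integral_iff \<alpha>_def prob_space)
    then show ?thesis by simp
  qed
  have R_X: "has_bochner_integral M (\<lambda>\<omega>. R \<omega> * X \<omega> k) 0" if k: "k < p" for k
  proof -
    have "has_bochner_integral M (\<lambda>\<omega>. X \<omega> k * Y \<omega> - \<alpha> * X \<omega> k - (\<Sum>j<p. \<beta> j * (X \<omega> j * X \<omega> k)))
            (\<beta> k - \<alpha> * 0 - (\<Sum>j<p. \<beta> j * (if j = k then 1 else 0)))"
      using Xi Yi mean XX XY k var
      by (intro has_bochner_integral_diff has_bochner_integral_sum has_bochner_integral_mult_right)
         (auto simp: has_bochner_integral_iff \<beta>_def)
    moreover have "(\<Sum>j<p. \<beta> j * (if j = k then 1 else 0)) = (\<Sum>j<p. if j = k then \<beta> k else 0)"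
      by (intro sum.cong) auto
    moreover have "X \<omega> k * Y \<omega> - \<alpha> * X \<omega> k - (\<Sum>j<p. \<beta> j * (X \<omega> j * X \<omega> k)) = R \<omega> * X \<omega> k" for \<omega>
      by (simp add: R_def algebra_simps sum_distrib_left sum_distrib_right)
    ultimately show ?thesis using k by simp
  qed
  have f_eq: "f (a, b) = expectation (\<lambda>\<omega>. (R \<omega>)\<^sup>2) + (\<alpha> - a)\<^sup>2 + (\<Sum>j<p. (\<beta> j - b j)\<^sup>2)" for a b
  proof -
    define L where "L \<omega> = (\<Sum>j<p. (\<beta> j - b j) * X \<omega> j)" for \<omega>
    have "(\<lambda>\<omega>. (Y \<omega> - a - (\<Sum>j<p. b j * X \<omega> j))\<^sup>2)
        = (\<lambda>\<omega>. (R \<omega>)\<^sup>2 + (\<alpha> - a)\<^sup>2 + (L \<omega>)\<^sup>2 + 2 * (\<alpha> - a) * R \<omega>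
            + (\<Sum>j<p. 2 * (\<beta> j - b j) * (R \<omega> * X \<omega> j)) + (\<Sum>j<p. 2 * (\<alpha> - a) * (\<beta> j - b j) * X \<omega> j))"
    proof
      fix \<omega>
      have "Y \<omega> - a - (\<Sum>j<p. b j * X \<omega> j) = R \<omega> + (\<alpha> - a) + L \<omega>"
        by (simp add: R_def L_def algebra_simps sum_subtractf)
      moreover have "(\<Sum>j<p. 2 * (\<beta> j - b j) * (R \<omega> * X \<omega> j)) = 2 * R \<omega> * L \<omega>"
        by (simp add: L_def sum_distrib_left mult_ac)
      moreover have "(\<Sum>j<p. 2 * (\<alpha> - a) * (\<beta> j - b j) * X \<omega> j) = 2 * (\<alpha> - a) * L \<omega>"
        by (simp add: L_def sum_distrib_left mult_ac)
      ultimately show "(Y \<omega> - a - (\<Sum>j<p. b j * X \<omega> j))\<^sup>2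
        = (R \<omega>)\<^sup>2 + (\<alpha> - a)\<^sup>2 + (L \<omega>)\<^sup>2 + 2 * (\<alpha> - a) * R \<omega>
            + (\<Sum>j<p. 2 * (\<beta> j - b j) * (R \<omega> * X \<omega> j)) + (\<Sum>j<p. 2 * (\<alpha> - a) * (\<beta> j - b j) * X \<omega> j)"
        by (simp add: power2_eq_square algebra_simps)
    qed
    moreover have "has_bochner_integral M \<dots>
        (expectation (\<lambda>\<omega>. (R \<omega>)\<^sup>2) + (\<alpha> - a)\<^sup>2 + (\<Sum>j<p. (\<beta> j - b j)\<^sup>2) + 2 * (\<alpha> - a) * 0
            + (\<Sum>j<p. 2 * (\<beta> j - b j) * 0) + (\<Sum>j<p. 2 * (\<alpha> - a) * (\<beta> j - b j) * 0))"
      using R2 lin2[of "\<lambda>j. \<beta> j - b j"] R_mean R_X Xi mean unfolding L_def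
      by (intro has_bochner_integral_add has_bochner_integral_sum has_bochner_integral_mult_right)
         (auto simp: has_bochner_integral_iff prob_space)
    ultimately show ?thesis
      by (simp add: f_def has_bochner_integral_iff)
  qed
  \<comment> \<open>Membership in the space of \<open>Rvec p\<close> forces coordinates beyond \<open>p\<close> to be undefined, so the
    admissible minimizer is the restriction of \<open>\<beta>\<close>.\<close>
  let ?P = "\<lambda>(a::real, b). b \<in> space (Rvec p)"
  have f0: "f (\<alpha>, restrict \<beta> {..<p}) = expectation (\<lambda>\<omega>. (R \<omega>)\<^sup>2)"
    by (simp add: f_eq)
  have "snd (arg_min f ?P) j = \<beta> j"
  proof (rule arg_minI[where x="(\<alpha>, restrict \<beta> {..<p})"])
    show P0: "?P (\<alpha>, restrict \<beta> {..<p})"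
      by (simp add: space_PiM)
    show "\<not> f y < f (\<alpha>, restrict \<beta> {..<p})" for y
      unfolding f0 by (cases y) (simp add: f_eq not_less sum_nonneg)
    show "snd x j = \<beta> j" if "\<forall>y. ?P y \<longrightarrow> \<not> f y < f x" for x
    proof -
      obtain a b where x: "x = (a, b)" by (cases x)
      have "f (a, b) \<le> expectation (\<lambda>\<omega>. (R \<omega>)\<^sup>2)"
        using that P0 f0 x by (metis not_less)
      then have "(\<Sum>j<p. (\<beta> j - b j)\<^sup>2) \<le> 0"
        unfolding f_eq using zero_le_power2[of "\<alpha> - a"] by linarith
      then have "(\<Sum>j<p. (\<beta> j - b j)\<^sup>2) = 0"
        by (simp add: sum_nonneg antisym)
      then have "(\<beta> j - b j)\<^sup>2 = 0"
        using j by (subst (asm) sum_nonneg_eq_0_iff) auto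
      then show ?thesis by (simp add: x)
    qed
  qed
  then show ?thesis
    by (simp add: best_linear_predictor_def f_def \<beta>_def)
qed

section \<open>Sums over pairs of independent centred vectors\<close>

text \<open>
  One coordinate of the Hoeffding decomposition: each index lies in \<open>n - 1\<close> pairs, which gives the
  coefficient of the linear term.  The identity holds for \<open>n = 0\<close> too, since the linear sum is
  then empty.
\<close>

lemma sum_pairs_shift:
  fixes b :: real and v :: "nat \<Rightarrow> real"
  shows "(\<Sum>k<n. \<Sum>i<k. (b + v i) * (b + v k))
    = real n * (real n - 1) / 2 * b\<^sup>2 + (real n - 1) * (b * (\<Sum>i<n. v i)) + (\<Sum>k<n. \<Sum>i<k. v i * v k)"
proof (induction n)
  case (Suc n)
  have "(\<Sum>i<n. (b + v i) * (b + v n)) = (real n * b + (\<Sum>i<n. v i)) * (b + v n)"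
    by (simp add: sum_distrib_right[symmetric] sum.distrib)
  moreover have "(\<Sum>i<n. v i * v n) = (\<Sum>i<n. v i) * v n"
    by (simp add: sum_distrib_right)
  ultimately show ?case
    by (simp add: Suc.IH) (simp add: field_simps power2_eq_square)
qed simp

lemma real_choose_two: "real (n choose 2) = real n * (real n - 1) / 2"
  by (induction n) (auto simp: numeral_2_eq_2 field_simps)

locale centred_independent_vectors = prob_space M for M :: "'a measure" +
  fixes n p :: nat and V :: "nat \<Rightarrow> 'a \<Rightarrow> nat \<Rightarrow> real" and C :: "nat \<Rightarrow> nat \<Rightarrow> real"
  assumes indep: "indep_vars (\<lambda>_. Rvec p) V {..<n}"
    and square_integrable: "\<And>i j. i < n \<Longrightarrow> j < p \<Longrightarrow> integrable M (\<lambda>\<omega>. (V i \<omega> j)\<^sup>2)"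
    and centred: "\<And>i j. i < n \<Longrightarrow> j < p \<Longrightarrow> expectation (\<lambda>\<omega>. V i \<omega> j) = 0"
    and covariance: "\<And>i j k. i < n \<Longrightarrow> j < p \<Longrightarrow> k < p \<Longrightarrow>
                       expectation (\<lambda>\<omega>. V i \<omega> j * V i \<omega> k) = C j k"
begin

definition partial_sum :: "nat \<Rightarrow> 'a \<Rightarrow> nat \<Rightarrow> real" where
  "partial_sum m \<omega> j = (\<Sum>i<m. V i \<omega> j)"

definition pair_sum :: "nat \<Rightarrow> 'a \<Rightarrow> real" where
  "pair_sum m \<omega> = (\<Sum>k<m. \<Sum>i<k. \<Sum>j<p. V i \<omega> j * V k \<omega> j)"

lemma V_measurable:
  assumes "i < n" "j < p"
  shows "(\<lambda>\<omega>. V i \<omega> j) \<in> borel_measurable M"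
proof -
  have "V i \<in> measurable M (Rvec p)"
    using indep assms by (simp add: indep_vars_def2)
  then show ?thesis
    using assms measurable_compose[OF _ measurable_component_singleton[of j "{..<p}" "\<lambda>_. borel"]]
    by simp
qed

lemma partial_sum_measurable:
  assumes "m \<le> n" "j < p"
  shows "(\<lambda>\<omega>. partial_sum m \<omega> j) \<in> borel_measurable M"
  unfolding partial_sum_def using assms by (intro borel_measurable_sum V_measurable) auto

lemma pair_sum_measurable:
  assumes "m \<le> n"
  shows "pair_sum m \<in> borel_measurable M"
  unfolding pair_sum_def using assms
  by (intro borel_measurable_sum borel_measurable_times V_measurable) auto

lemma pair_sum_Suc:
  "pair_sum (Suc m) \<omega> = pair_sum m \<omega> + (\<Sum>j<p. partial_sum m \<omega> j * V m \<omega> j)"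
  unfolding pair_sum_def partial_sum_def
  by (simp add: sum_distrib_right) (rule sum.swap)

text \<open>
  The martingale step: a quantity determined by \<open>V\<^sub>i\<close> with \<open>i < m\<close> is independent of \<open>V\<^sub>m\<close>.
  That \<open>F\<close> depends on the past alone is expressed by a measurable \<open>f\<close> on the product space of
  the first \<open>m\<close> vectors.
\<close>

lemma past_times_current:
  fixes f :: "(nat \<Rightarrow> nat \<Rightarrow> real) \<Rightarrow> real" and g :: "(nat \<Rightarrow> real) \<Rightarrow> real"
  assumes m: "m < n"
    and f: "f \<in> borel_measurable (PiM {..<m} (\<lambda>_. Rvec p))"
    and g: "g \<in> borel_measurable (Rvec p)"
    and F: "\<And>\<omega>. F \<omega> = f (\<lambda>i\<in>{..<m}. V i \<omega>)"
    and "integrable M F" "has_bochner_integral M (\<lambda>\<omega>. g (V m \<omega>)) c"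
  shows "has_bochner_integral M (\<lambda>\<omega>. F \<omega> * g (V m \<omega>)) (expectation F * c)"
proof -
  have "indep_var (PiM {..<m} (\<lambda>_. Rvec p)) (\<lambda>\<omega>. \<lambda>i\<in>{..<m}. V i \<omega>)
          (PiM {m} (\<lambda>_. Rvec p)) (\<lambda>\<omega>. \<lambda>i\<in>{m}. V i \<omega>)"
    using m by (intro indep_var_restrict[OF indep]) auto
  moreover have "(\<lambda>v. g (v m)) \<in> borel_measurable (PiM {m} (\<lambda>_. Rvec p))"
    by (rule measurable_compose[OF measurable_component_singleton[of m "{m}" "\<lambda>_. Rvec p"] g]) simp
  ultimately have "indep_var borel (f \<circ> (\<lambda>\<omega>. \<lambda>i\<in>{..<m}. V i \<omega>))
      borel ((\<lambda>v. g (v m)) \<circ> (\<lambda>\<omega>. \<lambda>i\<in>{m}. V i \<omega>))"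
    using f by (intro indep_var_compose)
  moreover have "f \<circ> (\<lambda>\<omega>. \<lambda>i\<in>{..<m}. V i \<omega>) = F"
    by (simp add: fun_eq_iff F)
  moreover have "(\<lambda>v. g (v m)) \<circ> (\<lambda>\<omega>. \<lambda>i\<in>{m}. V i \<omega>) = (\<lambda>\<omega>. g (V m \<omega>))"
    by (simp add: fun_eq_iff)
  ultimately have "indep_var borel F borel (\<lambda>\<omega>. g (V m \<omega>))"
    by simp
  from indep_var_integrable[OF this] indep_var_lebesgue_integral[OF this] assms(5,6)
  show ?thesis by (simp add: has_bochner_integral_iff)
qed

lemma past_coordinate_measurable:
  assumes "i < m" "j < p"
  shows "(\<lambda>v. v i j) \<in> borel_measurable (PiM {..<m} (\<lambda>_. Rvec p))"
  using assms
  by (intro measurable_compose[OF measurable_component_singleton[of i]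
        measurable_component_singleton[of j "{..<p}" "\<lambda>_. borel"]]) auto

lemma coordinate_measurable: "j < p \<Longrightarrow> (\<lambda>v. v j) \<in> borel_measurable (Rvec p)"
  using measurable_component_singleton[of j "{..<p}" "\<lambda>_. borel"] by simp

lemma V_integral:
  assumes "i < n" "j < p"
  shows "has_bochner_integral M (\<lambda>\<omega>. V i \<omega> j) 0"
  using assms square_integrable_imp_integrable[OF V_measurable square_integrable] centred
  by (simp add: has_bochner_integral_iff)

lemma V_product_integral:
  assumes "i < n" "j < p" "k < p"
  shows "has_bochner_integral M (\<lambda>\<omega>. V i \<omega> j * V i \<omega> k) (C j k)"
  using assms by (simp add: has_bochner_integral_iff covariance
      integrable_mult_of_square_integrable V_measurable square_integrable)

lemma partial_sum_square_integrable:
  assumes "m \<le> n" "j < p"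
  shows "integrable M (\<lambda>\<omega>. (partial_sum m \<omega> j)\<^sup>2)"
  using assms(1)
proof (induction m)
  case (Suc m)
  then have "integrable M (\<lambda>\<omega>. (partial_sum m \<omega> j + V m \<omega> j)\<^sup>2)"
    using assms by (intro integrable_square_add partial_sum_measurable V_measurable square_integrable) auto
  then show ?case by (simp add: partial_sum_def)
qed (simp add: partial_sum_def)

text \<open>
  Covariances of independent centred vectors add.  For unequal coordinates this yields the matrix
  entries, which the second moment of \<open>S\<^sub>m\<^sup>T V\<^sub>m\<close> and of any fixed combination of coordinates needs.
\<close>

lemma partial_sum_covariance:
  assumes "m \<le> n" "j < p" "k < p"
  shows "has_bochner_integral M (\<lambda>\<omega>. partial_sum m \<omega> j * partial_sum m \<omega> k) (real m * C j k)"
  using assms(1)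
proof (induction m)
  case (Suc m)
  have cross: "has_bochner_integral M (\<lambda>\<omega>. partial_sum m \<omega> j' * V m \<omega> k') 0"
    if "j' < p" "k' < p" for j' k'
  proof -
    have "has_bochner_integral M (\<lambda>\<omega>. partial_sum m \<omega> j' * V m \<omega> k')
            (expectation (\<lambda>\<omega>. partial_sum m \<omega> j') * 0)"
      using that Suc.prems
      by (intro past_times_current[where f="\<lambda>v. \<Sum>i<m. v i j'" and g="\<lambda>v. v k'"]
            borel_measurable_sum past_coordinate_measurable coordinate_measurable V_integral
            square_integrable_imp_integrable[OF partial_sum_measurable partial_sum_square_integrable])
         (auto simp: partial_sum_def)
    then show ?thesis by simp
  qed
  have "has_bochner_integral M
      (\<lambda>\<omega>. partial_sum m \<omega> j * partial_sum m \<omega> k + partial_sum m \<omega> j * V m \<omega> k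
          + partial_sum m \<omega> k * V m \<omega> j + V m \<omega> j * V m \<omega> k)
      (real m * C j k + 0 + 0 + C j k)"
    using Suc assms by (intro has_bochner_integral_add cross V_product_integral Suc.IH) auto
  then show ?case by (simp add: partial_sum_def algebra_simps)
qed (simp add: partial_sum_def has_bochner_integral_zero)

text \<open>
  In \<open>D\<^sub>m\<^sub>+\<^sub>1 = D\<^sub>m + S\<^sub>m\<^sup>T V\<^sub>m\<close> the cross term has mean zero because \<open>V\<^sub>m\<close> is centred and
  independent of \<open>(D\<^sub>m, S\<^sub>m)\<close>; the squared increment contributes
  \<open>\<Sum>\<^sub>j\<^sub>k E(S\<^sub>m\<^sub>j S\<^sub>m\<^sub>k) C\<^sub>j\<^sub>k = m \<parallel>C\<parallel>\<^sub>F\<^sup>2\<close>, and \<open>0 + 1 + \<dots> + (m - 1) = m(m - 1)/2\<close>.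
\<close>

lemma pair_sum_second_moment:
  assumes "m \<le> n"
  shows "has_bochner_integral M (\<lambda>\<omega>. (pair_sum m \<omega>)\<^sup>2)
           (real m * (real m - 1) / 2 * (\<Sum>j<p. \<Sum>k<p. (C j k)\<^sup>2))"
  using assms
proof (induction m)
  case (Suc m)
  then have m: "m < n" "m \<le> n" by simp_all
  note IH = Suc.IH[OF m(2)]
  have linear: "has_bochner_integral M (\<lambda>\<omega>. pair_sum m \<omega> * partial_sum m \<omega> j * V m \<omega> j) 0"
    if j: "j < p" for j
  proof -
    have "integrable M (\<lambda>\<omega>. pair_sum m \<omega> * partial_sum m \<omega> j)"
      using m j IH
      by (intro integrable_mult_of_square_integrable pair_sum_measurable partial_sum_measurable
           partial_sum_square_integrable) (auto simp: has_bochner_integral_iff)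
    then have "has_bochner_integral M (\<lambda>\<omega>. (pair_sum m \<omega> * partial_sum m \<omega> j) * V m \<omega> j)
            (expectation (\<lambda>\<omega>. pair_sum m \<omega> * partial_sum m \<omega> j) * 0)"
      using m j
      by (intro past_times_current[where g="\<lambda>v. v j"
              and f="\<lambda>v. (\<Sum>k<m. \<Sum>i<k. \<Sum>l<p. v i l * v k l) * (\<Sum>i<m. v i j)"]
            borel_measurable_sum borel_measurable_times past_coordinate_measurable
            coordinate_measurable V_integral)
         (auto simp: partial_sum_def pair_sum_def)
    then show ?thesis by simp
  qed
  have quadratic: "has_bochner_integral M
      (\<lambda>\<omega>. partial_sum m \<omega> j * partial_sum m \<omega> k * (V m \<omega> j * V m \<omega> k)) (real m * (C j k)\<^sup>2)"
    if jk: "j < p" "k < p" for j k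
  proof -
    note S = partial_sum_covariance[OF m(2) jk]
    have "has_bochner_integral M
        (\<lambda>\<omega>. partial_sum m \<omega> j * partial_sum m \<omega> k * (V m \<omega> j * V m \<omega> k))
        (expectation (\<lambda>\<omega>. partial_sum m \<omega> j * partial_sum m \<omega> k) * C j k)"
      using m jk S
      by (intro past_times_current[where g="\<lambda>v. v j * v k"
              and f="\<lambda>v. (\<Sum>i<m. v i j) * (\<Sum>i<m. v i k)"]
            borel_measurable_sum borel_measurable_times past_coordinate_measurable
            coordinate_measurable V_product_integral)
         (auto simp: partial_sum_def has_bochner_integral_iff)
    then show ?thesis
      using S by (simp add: has_bochner_integral_iff power2_eq_square mult.assoc)
  qed
  have "has_bochner_integral M
      (\<lambda>\<omega>. (pair_sum m \<omega>)\<^sup>2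
          + 2 * (\<Sum>j<p. pair_sum m \<omega> * partial_sum m \<omega> j * V m \<omega> j)
          + (\<Sum>j<p. \<Sum>k<p. partial_sum m \<omega> j * partial_sum m \<omega> k * (V m \<omega> j * V m \<omega> k)))
      (real m * (real m - 1) / 2 * (\<Sum>j<p. \<Sum>k<p. (C j k)\<^sup>2)
          + 2 * (\<Sum>j<p. 0) + (\<Sum>j<p. \<Sum>k<p. real m * (C j k)\<^sup>2))"
    by (intro has_bochner_integral_add has_bochner_integral_mult_right has_bochner_integral_sum
          IH linear quadratic) auto
  moreover have "(\<lambda>\<omega>. (pair_sum m \<omega>)\<^sup>2
          + 2 * (\<Sum>j<p. pair_sum m \<omega> * partial_sum m \<omega> j * V m \<omega> j)
          + (\<Sum>j<p. \<Sum>k<p. partial_sum m \<omega> j * partial_sum m \<omega> k * (V m \<omega> j * V m \<omega> k)))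
      = (\<lambda>\<omega>. (pair_sum (Suc m) \<omega>)\<^sup>2)"
    by (simp add: pair_sum_Suc fun_eq_iff power2_sum sum_distrib_left power2_eq_square[of "sum _ _"]
          sum_product mult_ac)
  moreover have "real m * (real m - 1) / 2 * (\<Sum>j<p. \<Sum>k<p. (C j k)\<^sup>2)
          + 2 * (\<Sum>j<p. 0) + (\<Sum>j<p. \<Sum>k<p. real m * (C j k)\<^sup>2)
      = real (Suc m) * (real (Suc m) - 1) / 2 * (\<Sum>j<p. \<Sum>k<p. (C j k)\<^sup>2)"
    by (simp add: sum_distrib_left[symmetric] field_simps)
  ultimately show ?case by (simp only:)
qed (simp add: pair_sum_def has_bochner_integral_zero)

text \<open>
  \<open>U\<close> is the error of the pairwise average of the vectors \<open>b + V\<^sub>i\<close> as an estimate of \<open>\<parallel>b\<parallel>\<^sup>2\<close>.  Its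
  linear and quadratic parts are bounded separately through \<open>(x + y)\<^sup>2 \<le> 2x\<^sup>2 + 2y\<^sup>2\<close>, which costs a
  factor \<open>2\<close> but does not affect the order of the bound.
\<close>

lemma shifted_pair_average:
  fixes b :: "nat \<Rightarrow> real"
  assumes n: "2 \<le> n"
    and U: "\<And>\<omega>. U \<omega> = (\<Sum>k<n. \<Sum>i<k. \<Sum>j<p. (b j + V i \<omega> j) * (b j + V k \<omega> j)) / real (n choose 2)
                     - (\<Sum>j<p. (b j)\<^sup>2)"
  shows shifted_pair_average_measurable: "U \<in> borel_measurable M"
    and shifted_pair_average_square_integrable: "integrable M (\<lambda>\<omega>. (U \<omega>)\<^sup>2)"
    and shifted_pair_average_second_moment:
      "expectation (\<lambda>\<omega>. (U \<omega>)\<^sup>2) \<le> 8 / real n * (\<Sum>j<p. \<Sum>k<p. b j * b k * C j k)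
         + 4 / (real n * (real n - 1)) * (\<Sum>j<p. \<Sum>k<p. (C j k)\<^sup>2)"
proof -
  define L where "L \<omega> = (\<Sum>j<p. b j * partial_sum n \<omega> j)" for \<omega>
  define D where "D = pair_sum n"
  define c where "c = real n * (real n - 1) / 2"
  have c: "real (n choose 2) = c" "c > 0"
    using n by (simp_all add: c_def real_choose_two)
  have U_eq: "U \<omega> = 2 / real n * L \<omega> + 1 / c * D \<omega>" for \<omega>
  proof -
    have "(\<Sum>k<n. \<Sum>i<k. \<Sum>j<p. (b j + V i \<omega> j) * (b j + V k \<omega> j))
        = (\<Sum>j<p. \<Sum>k<n. \<Sum>i<k. (b j + V i \<omega> j) * (b j + V k \<omega> j))"
      by (simp add: sum.swap[of _ "{..<p}"])
    also have "\<dots> = (\<Sum>j<p. c * (b j)\<^sup>2 + (real n - 1) * (b j * partial_sum n \<omega> j)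
                        + (\<Sum>k<n. \<Sum>i<k. V i \<omega> j * V k \<omega> j))"
      by (simp add: sum_pairs_shift c_def partial_sum_def)
    also have "\<dots> = c * (\<Sum>j<p. (b j)\<^sup>2) + (real n - 1) * L \<omega> + D \<omega>"
      by (simp add: sum.distrib L_def D_def pair_sum_def sum_distrib_left[symmetric]
            sum.swap[of _ "{..<p}"])
    finally have "U \<omega> = (c * (\<Sum>j<p. (b j)\<^sup>2) + (real n - 1) * L \<omega> + D \<omega>) / c - (\<Sum>j<p. (b j)\<^sup>2)"
      by (simp add: U c(1))
    also have "\<dots> = (real n - 1) / c * L \<omega> + 1 / c * D \<omega>"
      using c(2) by (simp add: field_simps)
    also have "(real n - 1) / c = 2 / real n"
      using n by (simp add: c_def field_simps)
    finally show ?thesis .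
  qed
  have L_meas [measurable]: "L \<in> borel_measurable M"
    unfolding L_def
    by (intro borel_measurable_sum borel_measurable_times partial_sum_measurable) auto
  have D_meas [measurable]: "D \<in> borel_measurable M"
    unfolding D_def by (intro pair_sum_measurable) simp
  have L2: "has_bochner_integral M (\<lambda>\<omega>. (L \<omega>)\<^sup>2)
              (\<Sum>j<p. \<Sum>k<p. b j * b k * (real n * C j k))"
    unfolding L_def using partial_sum_covariance[of n]
    by (intro linear_combination_second_moment partial_sum_measurable partial_sum_square_integrable)
       (auto simp: has_bochner_integral_iff)
  have D2: "has_bochner_integral M (\<lambda>\<omega>. (D \<omega>)\<^sup>2) (c * (\<Sum>j<p. \<Sum>k<p. (C j k)\<^sup>2))"
    unfolding D_def c_def by (rule pair_sum_second_moment) simp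
  show "U \<in> borel_measurable M"
    unfolding U_eq[abs_def] by measurable
  show U2: "integrable M (\<lambda>\<omega>. (U \<omega>)\<^sup>2)"
    unfolding U_eq using L2 D2
    by (intro integrable_square_add) (auto simp: power_mult_distrib power_divide has_bochner_integral_iff)
  have bound: "has_bochner_integral M (\<lambda>\<omega>. 8 / (real n)\<^sup>2 * (L \<omega>)\<^sup>2 + 2 / c\<^sup>2 * (D \<omega>)\<^sup>2)
      (8 / (real n)\<^sup>2 * (\<Sum>j<p. \<Sum>k<p. b j * b k * (real n * C j k))
        + 2 / c\<^sup>2 * (c * (\<Sum>j<p. \<Sum>k<p. (C j k)\<^sup>2)))"
    by (intro has_bochner_integral_add has_bochner_integral_mult_right L2 D2)
  have "(U \<omega>)\<^sup>2 \<le> 8 / (real n)\<^sup>2 * (L \<omega>)\<^sup>2 + 2 / c\<^sup>2 * (D \<omega>)\<^sup>2" for \<omega>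
  proof -
    have "(x + y)\<^sup>2 \<le> 2 * x\<^sup>2 + 2 * y\<^sup>2" for x y :: real
      using sum_squares_bound[of x y] by (simp add: power2_sum)
    from this[of "2 / real n * L \<omega>" "1 / c * D \<omega>"] show ?thesis
      by (simp add: U_eq power_mult_distrib power_divide)
  qed
  then have "expectation (\<lambda>\<omega>. (U \<omega>)\<^sup>2)
      \<le> expectation (\<lambda>\<omega>. 8 / (real n)\<^sup>2 * (L \<omega>)\<^sup>2 + 2 / c\<^sup>2 * (D \<omega>)\<^sup>2)"
    using bound U2 by (intro integral_mono) (auto simp: has_bochner_integral_iff)
  also have "\<dots> = 8 / (real n)\<^sup>2 * (\<Sum>j<p. \<Sum>k<p. b j * b k * (real n * C j k))
        + 2 / c\<^sup>2 * (c * (\<Sum>j<p. \<Sum>k<p. (C j k)\<^sup>2))"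
    using bound by (simp add: has_bochner_integral_iff)
  also have "(\<Sum>j<p. \<Sum>k<p. b j * b k * (real n * C j k))
      = real n * (\<Sum>j<p. \<Sum>k<p. b j * b k * C j k)"
    by (simp add: sum_distrib_left mult_ac)
  also have "8 / (real n)\<^sup>2 * (real n * (\<Sum>j<p. \<Sum>k<p. b j * b k * C j k))
      = 8 / real n * (\<Sum>j<p. \<Sum>k<p. b j * b k * C j k)"
    by (simp add: power2_eq_square)
  also have "2 / c\<^sup>2 * (c * (\<Sum>j<p. \<Sum>k<p. (C j k)\<^sup>2))
      = 4 / (real n * (real n - 1)) * (\<Sum>j<p. \<Sum>k<p. (C j k)\<^sup>2)"
    using n by (simp add: c_def power2_eq_square)
  finally show "expectation (\<lambda>\<omega>. (U \<omega>)\<^sup>2) \<le> 8 / real n * (\<Sum>j<p. \<Sum>k<p. b j * b k * C j k)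
         + 4 / (real n * (real n - 1)) * (\<Sum>j<p. \<Sum>k<p. (C j k)\<^sup>2)" .
qed

end

section \<open>The mean squared error of the naive estimator\<close>

lemma frobenius_norm_nonneg: "0 \<le> frobenius_norm p A"
  by (simp add: frobenius_norm_def sum_nonneg)

lemma frobenius_norm_square: "(frobenius_norm p A)\<^sup>2 = (\<Sum>j<p. \<Sum>k<p. (A j k)\<^sup>2)"
  by (simp add: frobenius_norm_def sum_nonneg)

text \<open>
  Cauchy-Schwarz for the Frobenius inner product of \<open>A\<close> and the rank-one matrix \<open>bb\<^sup>T\<close>, whose
  norm is \<open>\<parallel>b\<parallel>\<^sup>2\<close>.
\<close>

lemma quadratic_form_le_frobenius_norm:
  "(\<Sum>j<p. \<Sum>k<p. b j * b k * A j k) \<le> frobenius_norm p A * (\<Sum>j<p. (b j)\<^sup>2)"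
proof (rule power2_le_imp_le)
  let ?I = "{..<p} \<times> {..<p}"
  have "(\<Sum>j<p. \<Sum>k<p. b j * b k * A j k)\<^sup>2 = (\<Sum>(j, k)\<in>?I. b j * b k * A j k)\<^sup>2"
    by (simp add: sum.cartesian_product)
  also have "\<dots> \<le> (\<Sum>(j, k)\<in>?I. (b j * b k)\<^sup>2) * (\<Sum>(j, k)\<in>?I. (A j k)\<^sup>2)"
    using Cauchy_Schwarz_ineq_sum[of "\<lambda>(j, k). b j * b k" "\<lambda>(j, k). A j k" ?I]
    by (simp add: case_prod_beta)
  also have "(\<Sum>(j, k)\<in>?I. (b j * b k)\<^sup>2) = (\<Sum>j<p. (b j)\<^sup>2)\<^sup>2"
    by (simp add: sum.cartesian_product[symmetric] power2_eq_square[of "sum _ _"] sum_product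
          power_mult_distrib)
  also have "(\<Sum>(j, k)\<in>?I. (A j k)\<^sup>2) = (frobenius_norm p A)\<^sup>2"
    by (simp add: frobenius_norm_square sum.cartesian_product)
  finally show "(\<Sum>j<p. \<Sum>k<p. b j * b k * A j k)\<^sup>2 \<le> (frobenius_norm p A * (\<Sum>j<p. (b j)\<^sup>2))\<^sup>2"
    by (simp add: power_mult_distrib mult.commute)
qed (simp add: frobenius_norm_nonneg sum_nonneg)

text \<open>
  Passing from second moments to covariances does not increase the Frobenius norm.  With
  \<open>t = \<parallel>b\<parallel>\<^sup>2\<close> and \<open>Q = b\<^sup>T A b\<close> one has \<open>b\<^sup>T C b = Q - t\<^sup>2\<close> and
  \<open>\<parallel>C\<parallel>\<^sub>F\<^sup>2 = \<parallel>A\<parallel>\<^sub>F\<^sup>2 - 2Q + t\<^sup>2\<close>; nonnegativity of \<open>b\<^sup>T C b\<close>, which is a variance in the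
  application, gives \<open>Q \<ge> t\<^sup>2\<close> and so \<open>\<parallel>C\<parallel>\<^sub>F\<^sup>2 \<le> \<parallel>A\<parallel>\<^sub>F\<^sup>2 - t\<^sup>2\<close>.
\<close>

lemma frobenius_norm_centred_le:
  assumes C: "\<And>j k. j < p \<Longrightarrow> k < p \<Longrightarrow> C j k = A j k - b j * b k"
    and nonneg: "0 \<le> (\<Sum>j<p. \<Sum>k<p. b j * b k * C j k)"
  shows "(\<Sum>j<p. \<Sum>k<p. b j * b k * C j k) \<le> frobenius_norm p A * (\<Sum>j<p. (b j)\<^sup>2)"
    and "(\<Sum>j<p. \<Sum>k<p. (C j k)\<^sup>2) \<le> (frobenius_norm p A)\<^sup>2"
proof -
  define Q where "Q = (\<Sum>j<p. \<Sum>k<p. b j * b k * A j k)"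
  define t where "t = (\<Sum>j<p. (b j)\<^sup>2)"
  have t2: "(\<Sum>j<p. \<Sum>k<p. (b j)\<^sup>2 * (b k)\<^sup>2) = t\<^sup>2"
    by (simp only: t_def power2_eq_square[of "sum _ _"] sum_product)
  have "(\<Sum>j<p. \<Sum>k<p. b j * b k * C j k) = (\<Sum>j<p. \<Sum>k<p. b j * b k * A j k - (b j)\<^sup>2 * (b k)\<^sup>2)"
    by (intro sum.cong) (simp_all add: C algebra_simps power2_eq_square)
  then have q: "(\<Sum>j<p. \<Sum>k<p. b j * b k * C j k) = Q - t\<^sup>2"
    by (simp add: sum_subtractf Q_def t2)
  then show "(\<Sum>j<p. \<Sum>k<p. b j * b k * C j k) \<le> frobenius_norm p A * (\<Sum>j<p. (b j)\<^sup>2)"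
    using quadratic_form_le_frobenius_norm[where b=b and A=A and p=p] zero_le_power2[of t]
    unfolding Q_def by linarith
  have "(\<Sum>j<p. \<Sum>k<p. (C j k)\<^sup>2)
      = (\<Sum>j<p. \<Sum>k<p. (A j k)\<^sup>2 - 2 * (b j * b k * A j k) + (b j)\<^sup>2 * (b k)\<^sup>2)"
    by (intro sum.cong) (simp_all add: C algebra_simps power2_eq_square)
  also have "\<dots> = (frobenius_norm p A)\<^sup>2 - 2 * Q + t\<^sup>2"
    by (simp add: sum.distrib sum_subtractf sum_distrib_left[symmetric] sum_distrib_right[symmetric]
          Q_def t_def[symmetric] power2_eq_square[of t] frobenius_norm_square)
  finally show "(\<Sum>j<p. \<Sum>k<p. (C j k)\<^sup>2) \<le> (frobenius_norm p A)\<^sup>2"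
    using nonneg zero_le_power2[of t] unfolding q by linarith
qed

lemma (in prob_space) iid_copies_has_bochner_integral:
  fixes h :: "'b \<Rightarrow> real"
  assumes iid: "iid_copies M S Z n Zs" and i: "i < n"
    and h [measurable]: "h \<in> borel_measurable S"
    and c: "has_bochner_integral M (\<lambda>\<omega>. h (Z \<omega>)) c"
  shows "has_bochner_integral M (\<lambda>\<omega>. h (Zs i \<omega>)) c"
proof -
  have [measurable]: "Z \<in> measurable M S" "Zs i \<in> measurable M S"
    and eq: "distr M S (Zs i) = distr M S Z"
    using iid i by (auto simp: iid_copies_def indep_vars_def2)
  show ?thesis
    using c integrable_distr_eq[of "Zs i" M S h] integrable_distr_eq[of Z M S h]
      integral_distr[of "Zs i" M S h] integral_distr[of Z M S h] eq
    by (simp add: has_bochner_integral_iff)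
qed

text \<open>
  The bound for shifted vectors applies to \<open>W\<^sub>i = \<beta> + V\<^sub>i\<close>.  The moments of \<open>V\<^sub>i\<close> are computed from
  \<open>(X, Y)\<close> and carried over to the copies by equality in distribution.
\<close>

lemma (in prob_space) naive_estimator_mean_squared_error:
  fixes X :: "'a \<Rightarrow> nat \<Rightarrow> real" and Y :: "'a \<Rightarrow> real"
  assumes n: "2 \<le> n"
    and iid: "iid_copies M (Rvec p \<Otimes>\<^sub>M borel) (\<lambda>\<omega>. (X \<omega>, Y \<omega>)) n (\<lambda>i \<omega>. (Xs i \<omega>, Ys i \<omega>))"
    and Y2: "integrable M (\<lambda>\<omega>. (Y \<omega>)\<^sup>2)"
    and X2: "\<And>j. j < p \<Longrightarrow> integrable M (\<lambda>\<omega>. (X \<omega> j)\<^sup>2)"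
    and mean: "\<And>j. j < p \<Longrightarrow> expectation (\<lambda>\<omega>. X \<omega> j) = 0"
    and var: "\<And>j k. j < p \<Longrightarrow> k < p \<Longrightarrow> cov_matrix M X j k = (if j = k then 1 else 0)"
    and W2: "\<And>j k. j < p \<Longrightarrow> k < p \<Longrightarrow> integrable M (\<lambda>\<omega>. W X Y \<omega> j * W X Y \<omega> k)"
    and a: "a = frobenius_norm p (second_moment_matrix M (W X Y))"
    and \<tau>: "\<tau> = signal_level M p X Y"
    and U: "U = (\<lambda>\<omega>. naive_estimator n p Xs Ys \<omega> - \<tau>)"
  shows "U \<in> borel_measurable M"
    and "integrable M (\<lambda>\<omega>. (U \<omega>)\<^sup>2)"
    and "expectation (\<lambda>\<omega>. (U \<omega>)\<^sup>2) \<le> 8 / real n * (a * \<tau>) + 4 / (real n * (real n - 1)) * a\<^sup>2"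
proof -
  let ?S = "Rvec p \<Otimes>\<^sub>M (borel :: real measure)"
  define \<beta> where "\<beta> j = expectation (\<lambda>\<omega>. X \<omega> j * Y \<omega>)" for j
  define A where "A = second_moment_matrix M (W X Y)"
  define C where "C j k = A j k - \<beta> j * \<beta> k" for j k
  define g where "g z = (\<lambda>j\<in>{..<p}. fst z j * snd z - \<beta> j)" for z :: "(nat \<Rightarrow> real) \<times> real"
  define V where "V i \<omega> = g (Xs i \<omega>, Ys i \<omega>)" for i \<omega>
  have Z: "(\<lambda>\<omega>. (X \<omega>, Y \<omega>)) \<in> measurable M ?S"
    using iid by (simp add: iid_copies_def)
  have coord: "(\<lambda>z. fst z j) \<in> borel_measurable ?S" if "j < p" for j
    using that by (intro measurable_compose[OF measurable_fst
        measurable_component_singleton[of j "{..<p}" "\<lambda>_. borel"]]) simp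
  have Ym: "Y \<in> borel_measurable M"
    using measurable_compose[OF Z measurable_snd] by simp
  have Xm: "(\<lambda>\<omega>. X \<omega> j) \<in> borel_measurable M" if "j < p" for j
    using measurable_compose[OF Z coord[OF that]] by simp
  have hm: "(\<lambda>z. fst z j * snd z - \<beta> j) \<in> borel_measurable ?S" if "j < p" for j
    using coord[OF that] by simp
  have gm: "g \<in> measurable ?S (Rvec p)"
    unfolding g_def using hm by (intro measurable_restrict) auto
  have XY: "has_bochner_integral M (\<lambda>\<omega>. X \<omega> j * Y \<omega>) (\<beta> j)" if "j < p" for j
    using integrable_mult_of_square_integrable[OF Xm Ym X2 Y2] that
    by (simp add: has_bochner_integral_iff \<beta>_def)
  have centred_one: "has_bochner_integral M (\<lambda>\<omega>. X \<omega> j * Y \<omega> - \<beta> j) 0" if "j < p" for j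
  proof -
    have "has_bochner_integral M (\<lambda>\<omega>. X \<omega> j * Y \<omega> - \<beta> j) (\<beta> j - \<beta> j)"
      using that by (intro has_bochner_integral_diff XY) (auto simp: has_bochner_integral_iff prob_space)
    then show ?thesis by simp
  qed
  have centred_two: "has_bochner_integral M (\<lambda>\<omega>. (X \<omega> j * Y \<omega> - \<beta> j) * (X \<omega> k * Y \<omega> - \<beta> k)) (C j k)"
    if jk: "j < p" "k < p" for j k
  proof -
    have "has_bochner_integral M
        (\<lambda>\<omega>. W X Y \<omega> j * W X Y \<omega> k - \<beta> j * (X \<omega> k * Y \<omega> - \<beta> k) - \<beta> k * (X \<omega> j * Y \<omega> - \<beta> j) - \<beta> j * \<beta> k)
        (A j k - \<beta> j * 0 - \<beta> k * 0 - \<beta> j * \<beta> k)"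
      using jk W2
      by (intro has_bochner_integral_diff has_bochner_integral_mult_right centred_one)
         (auto simp: has_bochner_integral_iff prob_space A_def second_moment_matrix_def)
    then show ?thesis
      by (simp add: W_def C_def algebra_simps)
  qed
  have V_int: "has_bochner_integral M (\<lambda>\<omega>. V i \<omega> j) 0" if "i < n" "j < p" for i j
    using iid_copies_has_bochner_integral[OF iid that(1) hm[OF that(2)], of 0] centred_one[OF that(2)] that
    by (simp add: V_def g_def)
  have V_prod: "has_bochner_integral M (\<lambda>\<omega>. V i \<omega> j * V i \<omega> k) (C j k)"
    if "i < n" "j < p" "k < p" for i j k
    using iid_copies_has_bochner_integral[OF iid that(1) borel_measurable_times[OF hm hm], of j k "C j k"]
      centred_two that
    by (simp add: V_def g_def)
  interpret centred_independent_vectors M n p V C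
  proof
    show "indep_vars (\<lambda>_. Rvec p) V {..<n}"
    proof -
      have "indep_vars (\<lambda>_. ?S) (\<lambda>i \<omega>. (Xs i \<omega>, Ys i \<omega>)) {..<n}"
        using iid by (simp add: iid_copies_def)
      from indep_vars_compose2[OF this, where Y="\<lambda>_. g" and N="\<lambda>_. Rvec p", OF gm]
      show ?thesis by (simp only: V_def[abs_def])
    qed
    show "integrable M (\<lambda>\<omega>. (V i \<omega> j)\<^sup>2)" if "i < n" "j < p" for i j
      using V_prod[OF that that(2)] by (simp add: has_bochner_integral_iff power2_eq_square)
    show "expectation (\<lambda>\<omega>. V i \<omega> j) = 0" if "i < n" "j < p" for i j
      using V_int[OF that] by (simp add: has_bochner_integral_iff)
    show "expectation (\<lambda>\<omega>. V i \<omega> j * V i \<omega> k) = C j k" if "i < n" "j < p" "k < p" for i j k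
      using V_prod[OF that] by (simp add: has_bochner_integral_iff)
  qed
  have \<tau>_eq: "\<tau> = (\<Sum>j<p. (\<beta> j)\<^sup>2)"
  proof -
    have XX: "expectation (\<lambda>\<omega>. X \<omega> j * X \<omega> k) = (if j = k then 1 else 0)" if "j < p" "k < p" for j k
      using var[OF that] mean that by (simp add: cov_matrix_def)
    have slope: "snd (best_linear_predictor M p X Y) j = \<beta> j" if "j < p" for j
      unfolding \<beta>_def by (rule best_linear_predictor_slope[OF Ym Xm Y2 X2 mean XX that])
    have "\<tau> = (\<Sum>j<p. \<Sum>k<p. \<beta> j * (if j = k then 1 else 0) * \<beta> k)"
      unfolding \<tau> signal_level_def Let_def by (intro sum.cong) (simp_all add: slope var)
    also have "\<dots> = (\<Sum>j<p. \<Sum>k<p. if j = k then (\<beta> j)\<^sup>2 else 0)"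
      by (intro sum.cong) (auto simp: power2_eq_square)
    also have "\<dots> = (\<Sum>j<p. (\<beta> j)\<^sup>2)"
      by simp
    finally show ?thesis .
  qed
  have U_eq: "U \<omega> = (\<Sum>k<n. \<Sum>i<k. \<Sum>j<p. (\<beta> j + V i \<omega> j) * (\<beta> j + V k \<omega> j)) / real (n choose 2)
                     - (\<Sum>j<p. (\<beta> j)\<^sup>2)" for \<omega>
    unfolding U naive_estimator_def \<tau>_eq by (simp add: V_def g_def W_def)
  show "U \<in> borel_measurable M"
    by (rule shifted_pair_average_measurable[OF n U_eq])
  show "integrable M (\<lambda>\<omega>. (U \<omega>)\<^sup>2)"
    by (rule shifted_pair_average_square_integrable[OF n U_eq])
  \<comment> \<open>\<open>\<beta>\<^sup>T C \<beta>\<close> is the variance of \<open>\<beta>\<^sup>T W\<close>.\<close>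
  have "has_bochner_integral M (\<lambda>\<omega>. (\<Sum>j<p. \<beta> j * (X \<omega> j * Y \<omega> - \<beta> j))\<^sup>2)
          (\<Sum>j<p. \<Sum>k<p. \<beta> j * \<beta> k * C j k)"
    using centred_two centred_one
    by (intro linear_combination_second_moment) (auto simp: has_bochner_integral_iff power2_eq_square)
  then have nonneg: "0 \<le> (\<Sum>j<p. \<Sum>k<p. \<beta> j * \<beta> k * C j k)"
    by (auto simp: has_bochner_integral_iff dest!: sym[of "expectation _"])
  have CA: "C j k = A j k - \<beta> j * \<beta> k" for j k
    by (simp add: C_def)
  note bounds = frobenius_norm_centred_le[OF CA nonneg, folded \<tau>_eq, folded a[folded A_def]]
  have "expectation (\<lambda>\<omega>. (U \<omega>)\<^sup>2) \<le> 8 / real n * (\<Sum>j<p. \<Sum>k<p. \<beta> j * \<beta> k * C j k)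
         + 4 / (real n * (real n - 1)) * (\<Sum>j<p. \<Sum>k<p. (C j k)\<^sup>2)"
    by (rule shifted_pair_average_second_moment[OF n U_eq])
  also have "\<dots> \<le> 8 / real n * (a * \<tau>) + 4 / (real n * (real n - 1)) * a\<^sup>2"
    using n bounds by (intro add_mono mult_left_mono) auto
  finally show "expectation (\<lambda>\<omega>. (U \<omega>)\<^sup>2) \<le> 8 / real n * (a * \<tau>) + 4 / (real n * (real n - 1)) * a\<^sup>2" .
qed

section \<open>Consistency of the naive estimator\<close>

theorem proposition3p2:
  fixes M :: "nat \<Rightarrow> 'a measure"
    and p :: "nat \<Rightarrow> nat"
    and X :: "nat \<Rightarrow> 'a \<Rightarrow> nat \<Rightarrow> real"
    and Y :: "nat \<Rightarrow> 'a \<Rightarrow> real"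
    and Xs :: "nat \<Rightarrow> nat \<Rightarrow> 'a \<Rightarrow> nat \<Rightarrow> real"
    and Ys :: "nat \<Rightarrow> nat \<Rightarrow> 'a \<Rightarrow> real"
  assumes prob: "\<And>n. prob_space (M n)"
    and iid: "\<And>n. iid_copies (M n) (Rvec (p n) \<Otimes>\<^sub>M borel)
                (\<lambda>\<omega>. (X n \<omega>, Y n \<omega>)) n (\<lambda>i \<omega>. (Xs n i \<omega>, Ys n i \<omega>))"
    and Y_sq: "\<And>n. integrable (M n) (\<lambda>\<omega>. (Y n \<omega>)\<^sup>2)"
    and X_sq: "\<And>n j. j < p n \<Longrightarrow> integrable (M n) (\<lambda>\<omega>. (X n \<omega> j)\<^sup>2)"
    and X_mean: "\<And>n j. j < p n \<Longrightarrow> (\<integral>\<omega>. X n \<omega> j \<partial>M n) = 0"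
    and X_var: "\<And>n j k. j < p n \<Longrightarrow> k < p n \<Longrightarrow>
                  cov_matrix (M n) (X n) j k = (if j = k then 1 else 0)"
    and A_exists: "\<And>n j k. j < p n \<Longrightarrow> k < p n \<Longrightarrow>
                  integrable (M n) (\<lambda>\<omega>. W (X n) (Y n) \<omega> j * W (X n) (Y n) \<omega> k)"
    and A_small: "(\<lambda>n. (frobenius_norm (p n) (second_moment_matrix (M n) (W (X n) (Y n))))\<^sup>2
                      / (real n)\<^sup>2) \<longlonglongrightarrow> 0"
    and tau_bounded: "bounded (range (\<lambda>n. signal_level (M n) (p n) (X n) (Y n)))"
  shows "tendsto_in_prob M
           (\<lambda>n \<omega>. naive_estimator n (p n) (Xs n) (Ys n) \<omega>
                   - signal_level (M n) (p n) (X n) (Y n)) 0"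
proof -
  define a where "a n = frobenius_norm (p n) (second_moment_matrix (M n) (W (X n) (Y n))) / real n" for n
  define \<tau> where "\<tau> n = signal_level (M n) (p n) (X n) (Y n)" for n
  define U where "U n \<omega> = naive_estimator n (p n) (Xs n) (Ys n) \<omega> - \<tau> n" for n \<omega>
  obtain B where B: "\<tau> n \<le> B" for n
    using tau_bounded unfolding bounded_iff \<tau>_def by (auto simp: abs_le_iff)
  have a_nonneg: "0 \<le> a n" for n
    by (simp add: a_def frobenius_norm_nonneg)
  have "(\<lambda>n. (a n)\<^sup>2) \<longlonglongrightarrow> 0"
    using A_small by (simp add: a_def power_divide)
  from tendsto_real_sqrt[OF this] have a_lim: "a \<longlonglongrightarrow> 0"
    using a_nonneg by simp
  have tail: "measure (M n) {\<omega> \<in> space (M n). \<bar>U n \<omega>\<bar> > \<epsilon>} \<le> (8 * B * a n + 8 * (a n)\<^sup>2) / \<epsilon>\<^sup>2"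
    if n: "2 \<le> n" and \<epsilon>: "\<epsilon> > 0" for n \<epsilon>
  proof -
    interpret prob_space "M n" by (rule prob)
    define N where "N = frobenius_norm (p n) (second_moment_matrix (M n) (W (X n) (Y n)))"
    have N: "N = real n * a n"
      using n by (simp add: N_def a_def)
    have U_n: "U n = (\<lambda>\<omega>. naive_estimator n (p n) (Xs n) (Ys n) \<omega> - \<tau> n)"
      by (simp add: U_def fun_eq_iff)
    note mse = naive_estimator_mean_squared_error[OF n iid Y_sq X_sq X_mean X_var A_exists
        N_def \<tau>_def U_n]
    have meas [measurable]: "U n \<in> borel_measurable (M n)"
      by (rule mse(1))
    have "prob {\<omega> \<in> space (M n). \<bar>U n \<omega>\<bar> > \<epsilon>} \<le> prob {\<omega> \<in> space (M n). \<bar>U n \<omega>\<bar> \<ge> \<epsilon>}"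
      by (intro finite_measure_mono) auto
    also have "\<dots> \<le> expectation (\<lambda>\<omega>. (U n \<omega>)\<^sup>2) / \<epsilon>\<^sup>2"
      by (intro second_moment_method meas mse(2) \<epsilon>)
    also have "\<dots> \<le> (8 * B * a n + 8 * (a n)\<^sup>2) / \<epsilon>\<^sup>2"
    proof (intro divide_right_mono)
      have "8 / real n * (N * \<tau> n) \<le> 8 * B * a n"
        using n mult_right_mono[OF B[of n] a_nonneg[of n]] by (simp add: N mult.commute)
      \<comment> \<open>The factor \<open>8\<close> absorbs \<open>n / (n - 1) \<le> 2\<close>.\<close>
      moreover have "4 / (real n * (real n - 1)) * N\<^sup>2 \<le> 8 * (a n)\<^sup>2"
      proof -
        have "4 / (real n * (real n - 1)) * N\<^sup>2 = 4 * real n / (real n - 1) * (a n)\<^sup>2"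
          using n by (simp add: N power2_eq_square field_simps)
        also have "\<dots> \<le> 8 * (a n)\<^sup>2"
          using n by (intro mult_right_mono) (auto simp: field_simps)
        finally show ?thesis .
      qed
      ultimately show "expectation (\<lambda>\<omega>. (U n \<omega>)\<^sup>2) \<le> 8 * B * a n + 8 * (a n)\<^sup>2"
        using mse(3) by linarith
    qed simp
    finally show ?thesis .
  qed
  have "(\<lambda>n. measure (M n) {\<omega> \<in> space (M n). \<bar>U n \<omega>\<bar> > \<epsilon>}) \<longlonglongrightarrow> 0" if \<epsilon>: "\<epsilon> > 0" for \<epsilon>
  proof (rule tendsto_sandwich)
    show "\<forall>\<^sub>F n in sequentially. 0 \<le> measure (M n) {\<omega> \<in> space (M n). \<bar>U n \<omega>\<bar> > \<epsilon>}"
      by simp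
    show "\<forall>\<^sub>F n in sequentially. measure (M n) {\<omega> \<in> space (M n). \<bar>U n \<omega>\<bar> > \<epsilon>}
            \<le> (8 * B * a n + 8 * (a n)\<^sup>2) / \<epsilon>\<^sup>2"
      using eventually_ge_at_top[of 2] by eventually_elim (rule tail[OF _ \<epsilon>])
    have "(\<lambda>n. (8 * B * a n + 8 * (a n)\<^sup>2) / \<epsilon>\<^sup>2) \<longlonglongrightarrow> (8 * B * 0 + 8 * 0\<^sup>2) / \<epsilon>\<^sup>2"
      using \<epsilon> by (intro tendsto_intros a_lim) simp
    then show "(\<lambda>n. (8 * B * a n + 8 * (a n)\<^sup>2) / \<epsilon>\<^sup>2) \<longlonglongrightarrow> 0"
      by simp
  qed simp
  then show ?thesis
    by (simp add: tendsto_in_prob_def U_def \<tau>_def)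
qed

end
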